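(* Let $M$ be a region of a classical affine field theory with the data of the context, let $\zeta\in A_{\partial M}$ and let $\zeta=\zeta^{\mathrm{R}}+J_{\partial M}\zeta^{\mathrm{I}}$, $\zeta^{\mathrm{R}}\in A_{\tilde M}$, $\zeta^{\mathrm{I}}\in L_{\tilde M}$, be its unique decomposition with respect to the generalized direct sum $A_{\partial M}=A_{\tilde M}\oplus J_{\partial M}L_{\tilde M}$. Then the amplitude of the affine coherent state $\hat K_\zeta$ is $$\rho_M(\hat K_\zeta)=\exp\left(\mathrm{i}S_M(\zeta^{\mathrm{R}})-\mathrm{i}\,\theta_{\partial M}(\zeta^{\mathrm{R}},J_{\partial M}\zeta^{\mathrm{I}})-\frac{\mathrm{i}}2[J_{\partial M}\zeta^{\mathrm{I}},J_{\partial M}\zeta^{\mathrm{I}}]_{\partial M}-\frac12g_{\partial M}(\zeta^{\mathrm{I}},\zeta^{\mathrm{I}})\right).$$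
   Context: Data for the hypersurface $\Sigma=\partial M$: a complex separable Hilbert space $L_\Sigma$ with inner product $\{\cdot,\cdot\}_\Sigma$ (conjugate linear in the first, linear in the second argument), and an affine space $A_\Sigma$ over $L_\Sigma$ (free transitive abelian action, written $+$) with the induced topology. $g_\Sigma:=\Re\{\cdot,\cdot\}_\Sigma$, $\omega_\Sigma:=\frac12\Im\{\cdot,\cdot\}_\Sigma$, $J_\Sigma$ is multiplication by $\mathrm{i}$. There are continuous maps $\theta_\Sigma:A_\Sigma\times L_\Sigma\to\mathbb{R}$, real linear in the second argument, and $[\cdot,\cdot]_\Sigma:L_\Sigma\times L_\Sigma\to\mathbb{R}$, real bilinear, with $[\phi,\phi']_\Sigma+\theta_\Sigma(\eta,\phi')=\theta_\Sigma(\phi+\eta,\phi')$ and $\omega_\Sigma(\phi,\phi')=\frac12[\phi,\phi']_\Sigma-\frac12[\phi',\phi]_\Sigma$ for $\eta\in A_\Sigma$, $\phi,\phi'\in L_\Sigma$. Data for the region $M$: a real vector space $L_M$, an affine space $A_M$ over $L_M$, a map $S_M:A_M\to\mathbb{R}$, a map $a_M:A_M\to A_{\partial M}$ and a compatible real linear map $r_M:L_M\to L_{\partial M}$, with images $A_{\tilde M}$ and $L_{\tilde M}$ (these maps are omitted from notation). $L_{\tilde M}$ is a closed Lagrangian subspace of the real Hilbert space $L_{\partial M}$ with respect to $\omega_{\partial M}$. $S_M(\eta)=S_M(\eta')$ if $a_M(\eta)=a_M(\eta')$ (so $S_M$ is regarded as a function on $A_{\tilde M}$), and $S_M(\eta)=S_M(\eta')-\frac12\theta_{\partial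 M}(\eta,\eta-\eta')-\frac12\theta_{\partial M}(\eta',\eta-\eta')$ for all $\eta,\eta'\in A_M$. Coherent states: for $\zeta\in A_{\Sigma}$, $\hat K_\zeta:A_\Sigma\to\mathbb{C}$ is $\hat K_\zeta(\varphi):=\exp(\frac{\mathrm{i}}2\theta_\Sigma(\zeta,\varphi-\zeta)+\frac{\mathrm{i}}2\theta_\Sigma(\varphi,\varphi-\zeta)-\frac14g_\Sigma(\varphi-\zeta,\varphi-\zeta))$. Amplitude: for $\eta\in A_\Sigma$ let $\alpha_\Sigma^\eta(\varphi):=\exp(\frac{\mathrm{i}}2\theta_\Sigma(\eta,\varphi-\eta)+\frac{\mathrm{i}}2\theta_\Sigma(\varphi,\varphi-\eta)-\frac14g_\Sigma(\varphi-\eta,\varphi-\eta))$ and write a state $\psi:A_{\partial M}\to\mathbb{C}$ as $\psi(\varphi)=\chi^\eta(\varphi-\eta)\alpha_{\partial M}^\eta(\varphi)$, $\chi^\eta:L_{\partial M}\to\mathbb{C}$ holomorphic. For a real Hilbert space $L$, $\hat L$ is the algebraic dual of its topological dual ($L\subseteq\hat L$; continuous linear functionals, and hence their exponentials, extend to $\hat L$ by evaluation), with the $\sigma$-algebra generated by these functionals. $\nu_{\tilde M}$ is the centred Gaussian probability measure on $\hat L_{\tilde M}\subseteq\hat L_{\partial M}$ with $\int e^{\mathrm{i}g_{\partial M}(\xi,\phi)}\,\mathrm{d}\nu_{\tilde M}(\phi)=e^{-g_{\partial M}(\xi,\xi)}$ for $\xi\in L_{\tilde M}$ (heuristic density $e^{-\frac14g_{\partial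 M}(\phi,\phi)}$). With any base point $\eta\in A_M$ (also denoting its image in $A_{\partial M}$), $\rho_M(\psi):=\exp(\mathrm{i}S_M(\eta))\int_{\hat L_{\tilde M}}\chi^\eta(\phi)\,\mathrm{d}\nu_{\tilde M}(\phi)$ (with $\chi^\eta$ extended to $\hat L_{\tilde M}$), which does not depend on $\eta$. For coherent states, $\chi^\eta$ is a constant multiple of the exponential $e^{\frac12\{\zeta-\eta,\phi\}_{\partial M}}$ of a continuous linear functional. *)

theory Defs
  imports "HOL-Probability.Probability"
begin

section \<open>Complex Hilbert spaces\<close>

text \<open>
  The inner product is conjugate linear in the first argument.  The class extends
  \<^class>\<open>real_inner\<close>, so the real inner product, and with it norm and topology, is the
  real part of the complex one.  A complex Hilbert space is a type of sort
  \<open>{complex_inner, complete_space}\<close>.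
\<close>

class complex_inner = real_inner +
  fixes scaleC :: "complex \<Rightarrow> 'a \<Rightarrow> 'a"  (infixr "*\<^sub>C" 75)
    and cinner :: "'a \<Rightarrow> 'a \<Rightarrow> complex"
  assumes scaleC_add_right: "c *\<^sub>C (x + y) = c *\<^sub>C x + c *\<^sub>C y"
    and scaleC_add_left: "(c + d) *\<^sub>C x = c *\<^sub>C x + d *\<^sub>C x"
    and scaleC_scaleC: "c *\<^sub>C d *\<^sub>C x = (c * d) *\<^sub>C x"
    and scaleC_one: "1 *\<^sub>C x = x"
    and scaleR_eq_scaleC: "r *\<^sub>R x = complex_of_real r *\<^sub>C x"
    and cinner_add_right: "cinner x (y + z) = cinner x y + cinner x z"
    and cinner_scaleC_right: "cinner x (c *\<^sub>C y) = c * cinner x y"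
    and cinner_commute: "cinner x y = cnj (cinner y x)"
    and inner_eq_Re_cinner: "inner x y = Re (cinner x y)"

definition g_form :: "'l::complex_inner \<Rightarrow> 'l \<Rightarrow> real" where
  "g_form \<phi> \<phi>' = Re (cinner \<phi> \<phi>')"

definition omega_form :: "'l::complex_inner \<Rightarrow> 'l \<Rightarrow> real" where
  "omega_form \<phi> \<phi>' = 1/2 * Im (cinner \<phi> \<phi>')"

definition J_map :: "'l::complex_inner \<Rightarrow> 'l" where
  "J_map \<phi> = \<i> *\<^sub>C \<phi>"

text \<open>For a closed subspace, Lagrangian means equal to its own symplectic complement.\<close>

definition closed_lagrangian :: "'l::complex_inner set \<Rightarrow> bool" where
  "closed_lagrangian W \<longleftrightarrow>
     subspace W \<and> closed W \<and> W = {\<phi>. \<forall>\<phi>'\<in>W. omega_form \<phi> \<phi>' = 0}"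

section \<open>Classical affine field theory\<close>

locale affine_action =
  fixes act :: "'p \<Rightarrow> 'v::real_vector \<Rightarrow> 'p"
  assumes act_zero: "act p 0 = p"
    and act_add: "act (act p v) w = act p (v + w)"
    and act_free_transitive: "\<exists>!v. act p v = q"

definition aff_diff :: "('p \<Rightarrow> 'v \<Rightarrow> 'p) \<Rightarrow> 'p \<Rightarrow> 'p \<Rightarrow> 'v" where
  "aff_diff act q p = (THE v. act p v = q)"

text \<open>
  The topology of the affine space is the one induced from the Hilbert space: the
  translation maps are homeomorphisms.
\<close>

locale boundary_data = affine_action act
  for act :: "'a::topological_space \<Rightarrow> 'l::{complex_inner, complete_space} \<Rightarrow> 'a" +
  fixes \<theta> :: "'a \<Rightarrow> 'l \<Rightarrow> real"
    and br :: "'l \<Rightarrow> 'l \<Rightarrow> real"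
  assumes separable: "\<exists>D::'l set. countable D \<and> closure D = UNIV"
    and induced_topology: "homeomorphism UNIV UNIV (act p) (\<lambda>q. aff_diff act q p)"
    and theta_continuous: "continuous_on UNIV (\<lambda>(p, \<phi>). \<theta> p \<phi>)"
    and theta_linear: "linear (\<theta> p)"
    and br_continuous: "continuous_on UNIV (\<lambda>(\<phi>, \<phi>'). br \<phi> \<phi>')"
    and br_bilinear: "bilinear br"
    and theta_translate: "br \<phi> \<phi>' + \<theta> p \<phi>' = \<theta> (act p \<phi>) \<phi>'"
    and omega_br: "omega_form \<phi> \<phi>' = 1/2 * br \<phi> \<phi>' - 1/2 * br \<phi>' \<phi>"

locale region_data = boundary_data act \<theta> br + bulk: affine_action actM
  for act :: "'a::topological_space \<Rightarrow> 'l::{complex_inner, complete_space} \<Rightarrow> 'a"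
    and \<theta> :: "'a \<Rightarrow> 'l \<Rightarrow> real"
    and br :: "'l \<Rightarrow> 'l \<Rightarrow> real"
    and actM :: "'b \<Rightarrow> 'm::real_vector \<Rightarrow> 'b" +
  fixes S :: "'b \<Rightarrow> real"
    and a :: "'b \<Rightarrow> 'a"
    and r :: "'m \<Rightarrow> 'l"
  assumes r_linear: "linear r"
    and a_compatible: "a (actM \<eta> v) = act (a \<eta>) (r v)"
    and lagrangian: "closed_lagrangian (range r)"
    and S_boundary: "a \<eta> = a \<eta>' \<Longrightarrow> S \<eta> = S \<eta>'"
    and S_difference:
      "S \<eta> = S \<eta>' - 1/2 * \<theta> (a \<eta>) (r (aff_diff actM \<eta> \<eta>'))
                   - 1/2 * \<theta> (a \<eta>') (r (aff_diff actM \<eta> \<eta>'))"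

text \<open>The action regarded as a function on the image of \<open>a\<close>.\<close>

definition boundary_action :: "('b \<Rightarrow> 'a) \<Rightarrow> ('b \<Rightarrow> real) \<Rightarrow> 'a \<Rightarrow> real" where
  "boundary_action a S p = (THE s. \<exists>\<eta>. a \<eta> = p \<and> S \<eta> = s)"

section \<open>Coherent states\<close>

definition coherent_state ::
  "('a \<Rightarrow> 'l::complex_inner \<Rightarrow> 'a) \<Rightarrow> ('a \<Rightarrow> 'l \<Rightarrow> real) \<Rightarrow> 'a \<Rightarrow> 'a \<Rightarrow> complex" where
  "coherent_state act \<theta> \<zeta> \<phi> =
     exp (\<i>/2 * of_real (\<theta> \<zeta> (aff_diff act \<phi> \<zeta>))
        + \<i>/2 * of_real (\<theta> \<phi> (aff_diff act \<phi> \<zeta>))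
        - 1/4 * of_real (g_form (aff_diff act \<phi> \<zeta>) (aff_diff act \<phi> \<zeta>)))"

text \<open>
  The reference function \<open>\<alpha>\<^sup>\<eta>\<close> is given by the same formula as the coherent state at
  \<open>\<eta>\<close>.  It vanishes nowhere, so \<open>\<chi>\<^sup>\<eta>\<close> in \<open>\<psi> \<phi> = \<chi>\<^sup>\<eta> (\<phi> - \<eta>) * \<alpha>\<^sup>\<eta> \<phi>\<close> is a quotient.
\<close>

definition chi ::
  "('a \<Rightarrow> 'l::complex_inner \<Rightarrow> 'a) \<Rightarrow> ('a \<Rightarrow> 'l \<Rightarrow> real) \<Rightarrow> 'a \<Rightarrow> ('a \<Rightarrow> complex) \<Rightarrow> 'l \<Rightarrow> complex" where
  "chi act \<theta> \<eta> \<psi> v = \<psi> (act \<eta> v) / coherent_state act \<theta> \<eta> (act \<eta> v)"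

section \<open>Algebraic dual of the topological dual\<close>

text \<open>
  Functionals on a subspace \<open>W\<close> are represented by functions that are
  \<^const>\<open>undefined\<close> outside \<open>W\<close>; likewise for functionals on \<open>top_dual W\<close>.
\<close>

definition top_dual :: "'l::real_normed_vector set \<Rightarrow> ('l \<Rightarrow> real) set" where
  "top_dual W = {l \<in> extensional W.
     (\<forall>x\<in>W. \<forall>y\<in>W. l (x + y) = l x + l y) \<and>
     (\<forall>c. \<forall>x\<in>W. l (c *\<^sub>R x) = c * l x) \<and>
     continuous_on W l}"

definition hat :: "'l::real_normed_vector set \<Rightarrow> (('l \<Rightarrow> real) \<Rightarrow> real) set" where
  "hat W = {\<Phi> \<in> extensional (top_dual W).
     (\<forall>l\<in>top_dual W. \<forall>k\<in>top_dual W. \<Phi> (\<lambda>x\<in>W. l x + k x) = \<Phi> l + \<Phi> k) \<and>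
     (\<forall>c. \<forall>l\<in>top_dual W. \<Phi> (\<lambda>x\<in>W. c * l x) = c * \<Phi> l)}"

definition hat_sigma :: "'l::real_normed_vector set \<Rightarrow> (('l \<Rightarrow> real) \<Rightarrow> real) measure" where
  "hat_sigma W = sigma (hat W)
     {{\<Phi> \<in> hat W. \<Phi> l \<in> B} | l B. l \<in> top_dual W \<and> B \<in> sets borel}"

text \<open>The inclusion of \<open>hat W\<close> into \<open>hat UNIV\<close>.\<close>

definition hat_incl ::
  "'l::real_normed_vector set \<Rightarrow> (('l \<Rightarrow> real) \<Rightarrow> real) \<Rightarrow> (('l \<Rightarrow> real) \<Rightarrow> real)" where
  "hat_incl W \<Phi> = (\<lambda>l\<in>top_dual UNIV. \<Phi> (restrict l W))"

text \<open>
  The characteristic function determines the measure and expresses that it is centred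
  Gaussian.
\<close>

definition gaussian_on_hat :: "'l::complex_inner set \<Rightarrow> (('l \<Rightarrow> real) \<Rightarrow> real) measure \<Rightarrow> bool" where
  "gaussian_on_hat W \<nu> \<longleftrightarrow>
     prob_space \<nu> \<and> space \<nu> = hat W \<and> sets \<nu> = sets (hat_sigma W) \<and>
     (\<forall>\<xi>\<in>W. (\<integral>\<Phi>. exp (\<i> * of_real (\<Phi> (\<lambda>\<phi>\<in>W. g_form \<xi> \<phi>))) \<partial>\<nu>)
             = of_real (exp (- g_form \<xi> \<xi>)))"

section \<open>Amplitudes\<close>

definition complex_top_dual :: "('l::complex_inner \<Rightarrow> complex) set" where
  "complex_top_dual = {l. bounded_linear l \<and> (\<forall>c x. l (c *\<^sub>C x) = c * l x)}"

definition hat_eval :: "(('l \<Rightarrow> real) \<Rightarrow> real) \<Rightarrow> ('l \<Rightarrow> complex) \<Rightarrow> complex" where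
  "hat_eval \<Phi> l = Complex (\<Phi> (\<lambda>x. Re (l x))) (\<Phi> (\<lambda>x. Im (l x)))"

text \<open>
  Extension by evaluation to \<open>hat UNIV\<close>, for linear combinations of exponentials of
  continuous complex linear functionals.  It is well defined because exponentials of
  distinct functionals are linearly independent.
\<close>

definition hat_ext :: "('l::complex_inner \<Rightarrow> complex) \<Rightarrow> (('l \<Rightarrow> real) \<Rightarrow> real) \<Rightarrow> complex" where
  "hat_ext f \<Phi> = (THE w. \<exists>K c. finite K \<and> K \<subseteq> complex_top_dual \<and>
     f = (\<lambda>\<phi>. \<Sum>l\<in>K. c l * exp (l \<phi>)) \<and> w = (\<Sum>l\<in>K. c l * exp (hat_eval \<Phi> l)))"

text \<open>The amplitude of \<open>\<psi>\<close>, computed with the base point \<open>\<eta>\<close>.\<close>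

definition amplitude ::
  "('a \<Rightarrow> 'l::complex_inner \<Rightarrow> 'a) \<Rightarrow> ('a \<Rightarrow> 'l \<Rightarrow> real) \<Rightarrow> ('b \<Rightarrow> real) \<Rightarrow> ('b \<Rightarrow> 'a) \<Rightarrow> ('m \<Rightarrow> 'l) \<Rightarrow>
   (('l \<Rightarrow> real) \<Rightarrow> real) measure \<Rightarrow> 'b \<Rightarrow> ('a \<Rightarrow> complex) \<Rightarrow> complex" where
  "amplitude act \<theta> S a r \<nu> \<eta> \<psi> =
     exp (\<i> * of_real (S \<eta>)) *
     (\<integral>\<Phi>. hat_ext (chi act \<theta> (a \<eta>) \<psi>) (hat_incl (range r) \<Phi>) \<partial>\<nu>)"

end

theory Submission
  imports Defs "HOL-Complex_Analysis.Conformal_Mappings"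
begin

text \<open>
  For a closed Lagrangian subspace \<open>W\<close> the orthogonal complement with respect to \<open>g\<close> is
  \<open>J W\<close>, which gives the decomposition.  Writing \<open>\<zeta> = \<eta> + \<xi>\<close> with \<open>\<xi> = u + J v\<close> and
  \<open>u\<close>, \<open>v\<close> in \<open>W\<close>, the function \<open>\<chi>\<^sup>\<eta>\<close> is a constant times the exponential of half
  of \<open>{\<xi>, \<sqdot>}\<close>, which restricts to \<open>g(u, \<sqdot>) - i g(v, \<sqdot>)\<close> on \<open>W\<close>.  Its Gaussian
  integral follows from the characteristic function by analytic continuation in the real
  part of the functional; the terms that depend on \<open>\<eta>\<close> then recombine to the action at
  \<open>\<zeta>\<^sup>R\<close>, using \<open>[u, J v] - [J v, u] = 2 \<omega>(u, J v) = g(u, v)\<close>.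
\<close>

section \<open>Complex inner product spaces\<close>

lemma J_map_add: "J_map (x + y) = J_map x + J_map y"
  by (simp add: J_map_def scaleC_add_right)

lemma J_map_J_map [simp]: "J_map (J_map x) = - x"
  using scaleR_eq_scaleC[of "- 1" x] by (simp add: J_map_def scaleC_scaleC)

lemma J_map_scaleR: "J_map (c *\<^sub>R x) = c *\<^sub>R J_map x"
  by (simp add: J_map_def scaleR_eq_scaleC scaleC_scaleC mult.commute)

lemma linear_J_map: "linear J_map"
  by (intro linearI J_map_add J_map_scaleR)

lemmas J_map_diff = linear_diff[OF linear_J_map]
lemmas J_map_minus = linear_neg[OF linear_J_map]

lemma cinner_scaleC_left: "cinner (c *\<^sub>C x) y = cnj c * cinner x y"
  by (metis cinner_commute cinner_scaleC_right complex_cnj_mult)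

lemma g_form_eq_inner: "g_form x y = inner x y"
  by (simp add: g_form_def inner_eq_Re_cinner)

lemma Im_cinner: "Im (cinner x y) = inner (J_map x) y"
  by (simp add: J_map_def inner_eq_Re_cinner cinner_scaleC_left)

lemma omega_form_eq_inner: "omega_form x y = 1/2 * inner (J_map x) y"
  by (simp add: omega_form_def Im_cinner)

lemma inner_J_map_J_map: "inner (J_map x) (J_map y) = inner x y"
  by (simp add: J_map_def inner_eq_Re_cinner cinner_scaleC_left cinner_scaleC_right)

lemma inner_J_map_right: "inner x (J_map y) = - inner (J_map x) y"
  using inner_J_map_J_map[of x "J_map y"] by simp

text \<open>Makes \<open>cinner x\<close> admissible in \<open>hat_ext\<close>. Boundedness is
  checked on real and imaginary part, which are real inner products.\<close>

lemma cinner_in_complex_top_dual: "cinner x \<in> complex_top_dual"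
proof -
  have "cinner x = (\<lambda>y. complex_of_real (inner x y) + \<i> * complex_of_real (inner (J_map x) y))"
    by (simp add: fun_eq_iff complex_eq_iff Im_cinner flip: inner_eq_Re_cinner)
  moreover have "bounded_linear
      (\<lambda>y. complex_of_real (inner x y) + \<i> * complex_of_real (inner (J_map x) y))"
    by (intro bounded_linear_add bounded_linear_inner_right bounded_linear_const_mult
        bounded_linear_compose[OF bounded_linear_of_real])
  ultimately have "bounded_linear (cinner x)"
    by simp
  then show ?thesis
    by (simp add: complex_top_dual_def cinner_scaleC_right)
qed

section \<open>Lagrangian decomposition\<close>

text \<open>A minimizing sequence for the distance from \<open>x\<close> to \<open>W\<close> is
  Cauchy, its limit is a nearest point, and first variation along \<open>W\<close> gives
  orthogonality.\<close>

lemma orthogonal_projection_exists: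
  fixes x :: "'a::{real_inner, complete_space}"
  assumes W: "subspace W" "closed W"
  obtains w where "w \<in> W" "\<And>v. v \<in> W \<Longrightarrow> inner (x - w) v = 0"
proof -
  define D where "D = (INF v\<in>W. (norm (x - v))\<^sup>2)"
  have bdd: "bdd_below ((\<lambda>v. (norm (x - v))\<^sup>2) ` W)"
    by (intro bdd_belowI[of _ 0]) auto
  have D_le: "D \<le> (norm (x - v))\<^sup>2" if "v \<in> W" for v
    unfolding D_def using bdd that by (rule cINF_lower)
  have "W \<noteq> {}"
    using subspace_0[OF W(1)] by auto
  have "\<exists>v\<in>W. (norm (x - v))\<^sup>2 < D + 1 / real (Suc n)" for n
    using cINF_less_iff[OF \<open>W \<noteq> {}\<close> bdd, of "D + 1 / real (Suc n)"]
    by (simp add: D_def)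
  then obtain y where y: "\<And>n. y n \<in> W" "\<And>n. (norm (x - y n))\<^sup>2 < D + 1 / real (Suc n)"
    by metis
  \<comment> \<open>Parallelogram law for \<open>x - y m\<close> and \<open>x - y n\<close>: the
    midpoint of \<open>y m\<close> and \<open>y n\<close> lies in \<open>W\<close>, so its squared
    distance to \<open>x\<close> is at least \<open>D\<close>.\<close>
  have par: "(norm (y m - y n))\<^sup>2 \<le> 2 / real (Suc m) + 2 / real (Suc n)" for m n
  proof -
    have "(norm (y m - y n))\<^sup>2 = 2 * (norm (x - y m))\<^sup>2 + 2 * (norm (x - y n))\<^sup>2
        - 4 * (norm (x - (1/2) *\<^sub>R (y m + y n)))\<^sup>2"
      by (simp add: power2_norm_eq_inner algebra_simps inner_commute)
    moreover have "D \<le> (norm (x - (1/2) *\<^sub>R (y m + y n)))\<^sup>2"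
      using W(1) y(1) by (intro D_le subspace_scale subspace_add) auto
    ultimately show ?thesis
      using y(2)[of m] y(2)[of n] by simp
  qed
  have "Cauchy y"
  proof (rule CauchyI)
    fix e :: real
    assume "0 < e"
    then obtain N where N: "4 / e\<^sup>2 < real N"
      using reals_Archimedean2 by blast
    have "norm (y m - y n) < e" if "m \<ge> N" "n \<ge> N" for m n
    proof -
      have b: "2 / real (Suc k) < e\<^sup>2 / 2" if "k \<ge> N" for k
      proof -
        have "4 / e\<^sup>2 < real (Suc k)"
          using N that by linarith
        then show ?thesis
          using \<open>0 < e\<close> by (simp add: field_simps)
      qed
      have "(norm (y m - y n))\<^sup>2 < e\<^sup>2"
        using par[of m n] b[OF that(1)] b[OF that(2)] by linarith
      then show ?thesis
        using \<open>0 < e\<close> by (meson less_imp_le power_less_imp_less_base)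
    qed
    then show "\<exists>N. \<forall>m\<ge>N. \<forall>n\<ge>N. norm (y m - y n) < e"
      by blast
  qed
  then obtain w where lim: "y \<longlonglongrightarrow> w"
    using Cauchy_convergent convergent_def by blast
  have w: "w \<in> W"
    using closed_sequentially[OF W(2)] y(1) lim by blast
  have "(norm (x - w))\<^sup>2 \<le> D"
  proof (rule LIMSEQ_le)
    show "(\<lambda>n. (norm (x - y n))\<^sup>2) \<longlonglongrightarrow> (norm (x - w))\<^sup>2"
      by (intro tendsto_intros lim)
    show "(\<lambda>n. D + 1 / real (Suc n)) \<longlonglongrightarrow> D"
      using tendsto_add[OF tendsto_const LIMSEQ_inverse_real_of_nat, of D]
      by (simp add: inverse_eq_divide)
    show "\<exists>N. \<forall>n\<ge>N. (norm (x - y n))\<^sup>2 \<le> D + 1 / real (Suc n)"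
      using y(2) less_imp_le by blast
  qed
  then have min: "inner (x - w) (x - w) \<le> inner (x - v) (x - v)" if "v \<in> W" for v
    using D_le[OF that] by (simp add: power2_norm_eq_inner)
  have "inner (x - w) v = 0" if v: "v \<in> W" for v
  proof (cases "v = 0")
    case False
    \<comment> \<open>\<open>t *\<^sub>R v\<close> is the projection of \<open>x - w\<close> onto
      the line of \<open>v\<close>, the shift that would shorten \<open>x - w\<close> most.\<close>
    define t where "t = inner (x - w) v / inner v v"
    have "w + t *\<^sub>R v \<in> W"
      using W(1) w v by (intro subspace_add subspace_scale)
    from min[OF this] have "2 * t * inner (x - w) v \<le> t * (t * inner v v)"
      by (simp add: algebra_simps inner_commute)
    also have "t * inner v v = inner (x - w) v"
      using False by (simp add: t_def)
    finally have "t * inner (x - w) v \<le> 0"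
      by simp
    then have "(inner (x - w) v)\<^sup>2 / inner v v \<le> 0"
      by (simp add: t_def power2_eq_square)
    then show ?thesis
      using False inner_gt_zero_iff[of v]
      by (auto simp: divide_le_0_iff simp del: inner_gt_zero_iff)
  qed simp
  with w that show thesis
    by blast
qed

context
  fixes W :: "'l::{complex_inner, complete_space} set"
  assumes W: "closed_lagrangian W"
begin

lemma lagrangian_subspace: "subspace W"
  using W by (simp add: closed_lagrangian_def)

text \<open>Since \<omega>(x, v) is half of g(J x, v), the symplectic complement becomes an
  orthogonality condition. One direction is isotropy of \<open>W\<close>, the other
  maximality.\<close>

lemma lagrangian_iff: "x \<in> W \<longleftrightarrow> (\<forall>v\<in>W. inner (J_map x) v = 0)"
proof -
  have "W = {x. \<forall>v\<in>W. omega_form x v = 0}"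
    using W unfolding closed_lagrangian_def by blast
  then have "x \<in> W \<longleftrightarrow> (\<forall>v\<in>W. omega_form x v = 0)"
    by blast
  then show ?thesis
    by (simp add: omega_form_eq_inner)
qed

lemma lagrangian_decomposition:
  obtains u v where "u \<in> W" "v \<in> W" "x = u + J_map v"
proof -
  obtain u where u: "u \<in> W" "\<And>v. v \<in> W \<Longrightarrow> inner (x - u) v = 0"
    using orthogonal_projection_exists[of W x] W by (auto simp: closed_lagrangian_def)
  \<comment> \<open>J maps this vector to the residual \<open>x - u\<close>, which is orthogonal to
    \<open>W\<close>; maximality therefore places it in \<open>W\<close>.\<close>
  have "- J_map (x - u) \<in> W"
    unfolding lagrangian_iff using u(2) by (simp add: J_map_minus)
  moreover have "x = u + J_map (- J_map (x - u))"
    by (simp add: J_map_minus)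
  ultimately show thesis
    using that u(1) by blast
qed

text \<open>Isotropy makes \<open>J_map x\<close> orthogonal to \<open>W\<close>, hence to itself,
  and J is an isometry. This gives uniqueness of the decomposition.\<close>

lemma lagrangian_J_map_disjoint:
  assumes "x \<in> W" "J_map x \<in> W"
  shows "x = 0"
  using assms lagrangian_iff[of x] inner_J_map_J_map[of x x] by auto

end

section \<open>Extension of exponentials\<close>

lemma complex_top_dual_add: "l \<in> complex_top_dual \<Longrightarrow> l (x + y) = l x + l y"
  by (auto simp: complex_top_dual_def intro: linear_add bounded_linear.linear)

lemma complex_top_dual_scaleC: "l \<in> complex_top_dual \<Longrightarrow> l (c *\<^sub>C x) = c * l x"
  by (auto simp: complex_top_dual_def)

lemma exp_complex_top_dual_neq:
  assumes "l \<in> complex_top_dual" "k \<in> complex_top_dual" "l \<noteq> k"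
  obtains x where "exp (l x) \<noteq> exp (k x)"
proof -
  obtain x where x: "l x - k x \<noteq> 0"
    using assms(3) by auto
  \<comment> \<open>Complex homogeneity permits scaling the difference to exactly 1; an unscaled
    difference could be a multiple of 2 pi i, where the exponentials agree.\<close>
  define y where "y = inverse (l x - k x) *\<^sub>C x"
  have "l y - k y = 1"
    using x assms(1,2) by (simp add: y_def complex_top_dual_scaleC flip: right_diff_distrib)
  then have "exp (l y) / exp (k y) = exp 1"
    by (simp add: exp_diff[symmetric])
  moreover have "exp 1 \<noteq> (1::complex)"
  proof
    assume "exp 1 = (1::complex)"
    then have "norm (exp (1::complex)) = 1" by simp
    then show False by (simp add: norm_exp_eq_Re)
  qed
  ultimately have "exp (l y) \<noteq> exp (k y)"
    by auto
  with that show thesis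
    by blast
qed

text \<open>Dedekind's argument for the independence of characters.\<close>

lemma exp_complex_top_dual_independent:
  assumes "finite K" "K \<subseteq> complex_top_dual"
    and "\<And>x. (\<Sum>l\<in>K. c l * exp (l x)) = 0"
    and "l \<in> K"
  shows "c l = 0"
  using assms
proof (induction K arbitrary: c l rule: finite_induct)
  case (insert k K)
  have sum0: "c k * exp (k x) + (\<Sum>l\<in>K. c l * exp (l x)) = 0" for x
    using insert.prems(2)[of x] insert.hyps by simp
  have K0: "c l = 0" if "l \<in> K" for l
  proof -
    have lk: "l \<in> complex_top_dual" "k \<in> complex_top_dual" "l \<noteq> k"
      using insert.prems(1) insert.hyps(2) that by auto
    then obtain y where y: "exp (l y) \<noteq> exp (k y)"
      by (rule exp_complex_top_dual_neq)
    \<comment> \<open>Subtracting \<open>exp (k y)\<close> times the relation at \<open>x\<close>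
      from the relation at \<open>x + y\<close> cancels the term of \<open>k\<close> and leaves a
      relation over \<open>K\<close>.\<close>
    have "(\<Sum>l\<in>K. c l * (exp (l y) - exp (k y)) * exp (l x)) = 0" for x
    proof -
      have "(\<Sum>l\<in>K. c l * (exp (l y) - exp (k y)) * exp (l x))
          = (\<Sum>l\<in>K. c l * exp (l (x + y)) - exp (k y) * (c l * exp (l x)))"
        using insert.prems(1)
        by (intro sum.cong refl) (simp add: subset_iff complex_top_dual_add exp_add algebra_simps)
      also have "\<dots> = (\<Sum>l\<in>K. c l * exp (l (x + y))) - exp (k y) * (\<Sum>l\<in>K. c l * exp (l x))"
        by (simp add: sum_subtractf sum_distrib_left)
      also have "(\<Sum>l\<in>K. c l * exp (l (x + y))) = - (c k * exp (k x) * exp (k y))"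
        using sum0[of "x + y"]
        by (simp add: complex_top_dual_add[OF lk(2)] exp_add eq_neg_iff_add_eq_0 add.commute mult.assoc)
      also have "(\<Sum>l\<in>K. c l * exp (l x)) = - (c k * exp (k x))"
        using sum0[of x] by (simp add: eq_neg_iff_add_eq_0 add.commute)
      finally show ?thesis
        by simp
    qed
    then have "c l * (exp (l y) - exp (k y)) = 0"
      using insert.IH[of "\<lambda>l. c l * (exp (l y) - exp (k y))"] insert.prems(1) that by simp
    with y show ?thesis
      by simp
  qed
  moreover have "c k = 0"
    using sum0[of 0] K0 by simp
  ultimately show ?case
    using insert.prems(3) by auto
qed simp

text \<open>Discharges the definite description in \<open>hat_ext\<close>: by independence, two
  representations of one function differ only in zero coefficients.\<close>

lemma hat_ext_exp_sum:
  assumes K: "finite K" "K \<subseteq> complex_top_dual"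
  shows "hat_ext (\<lambda>x. \<Sum>l\<in>K. c l * exp (l x)) \<Phi> = (\<Sum>l\<in>K. c l * exp (hat_eval \<Phi> l))"
  unfolding hat_ext_def
proof (rule the_equality)
  fix w
  assume "\<exists>K' c'. finite K' \<and> K' \<subseteq> complex_top_dual \<and>
     (\<lambda>x. \<Sum>l\<in>K. c l * exp (l x)) = (\<lambda>x. \<Sum>l\<in>K'. c' l * exp (l x)) \<and>
     w = (\<Sum>l\<in>K'. c' l * exp (hat_eval \<Phi> l))"
  then obtain K' c' where K': "finite K'" "K' \<subseteq> complex_top_dual"
    and eq: "(\<lambda>x. \<Sum>l\<in>K. c l * exp (l x)) = (\<lambda>x. \<Sum>l\<in>K'. c' l * exp (l x))"
    and w: "w = (\<Sum>l\<in>K'. c' l * exp (hat_eval \<Phi> l))"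
    by (elim exE conjE)
  \<comment> \<open>Padding both coefficient families by zero puts them on the common index set
    \<open>K \<union> K'\<close>, where their difference is a vanishing relation.\<close>
  define d where "d l = (if l \<in> K then c l else 0) - (if l \<in> K' then c' l else 0)" for l
  have d_sum: "(\<Sum>l\<in>K \<union> K'. d l * f l) = (\<Sum>l\<in>K. c l * f l) - (\<Sum>l\<in>K'. c' l * f l)"
    for f :: "('a \<Rightarrow> complex) \<Rightarrow> complex"
  proof -
    have "(\<Sum>l\<in>K \<union> K'. d l * f l) = (\<Sum>l\<in>K \<union> K'. if l \<in> K then c l * f l else 0)
        - (\<Sum>l\<in>K \<union> K'. if l \<in> K' then c' l * f l else 0)"
      unfolding sum_subtractf[symmetric] by (intro sum.cong refl) (simp add: d_def left_diff_distrib)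
    also have "(\<Sum>l\<in>K \<union> K'. if l \<in> K then c l * f l else 0) = (\<Sum>l\<in>K. c l * f l)"
      using K(1) K'(1) by (intro sum.mono_neutral_cong_right) auto
    also have "(\<Sum>l\<in>K \<union> K'. if l \<in> K' then c' l * f l else 0) = (\<Sum>l\<in>K'. c' l * f l)"
      using K(1) K'(1) by (intro sum.mono_neutral_cong_right) auto
    finally show ?thesis .
  qed
  have "d l = 0" if "l \<in> K \<union> K'" for l
  proof (rule exp_complex_top_dual_independent[of "K \<union> K'" d])
    show "(\<Sum>l\<in>K \<union> K'. d l * exp (l x)) = 0" for x
      using d_sum[of "\<lambda>l. exp (l x)"] fun_cong[OF eq, of x] by simp
  qed (use K K' that in auto)
  then have "(\<Sum>l\<in>K \<union> K'. d l * exp (hat_eval \<Phi> l)) = 0"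
    by simp
  then show "w = (\<Sum>l\<in>K. c l * exp (hat_eval \<Phi> l))"
    using d_sum w by simp
qed (use K in blast)

section \<open>Exponential moments\<close>

text \<open>Completing the square: up to a constant factor, the weight \<open>exp (c * x)\<close>
  shifts the mean of the normal density to \<open>c\<close>.\<close>

lemma integrable_exp_std_normal:
  "integrable std_normal_distribution (\<lambda>x. exp (c * x))"
proof -
  have "std_normal_density x * exp (c * x) = exp (c\<^sup>2 / 2) * normal_density c 1 x" for x
  proof -
    have "- x\<^sup>2 / 2 + c * x = c\<^sup>2 / 2 - (x - c)\<^sup>2 / 2"
      by (simp add: power2_eq_square field_simps)
    then have "exp (- x\<^sup>2 / 2) * exp (c * x) = exp (c\<^sup>2 / 2) * exp (- (x - c)\<^sup>2 / 2)"
      by (simp flip: exp_add)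
    then show ?thesis
      by (simp add: normal_density_def)
  qed
  moreover have "integrable lborel (\<lambda>x. exp (c\<^sup>2 / 2) * normal_density c 1 x)"
    by (intro integrable_mult_right integrable_normal_density) simp
  ultimately have "integrable lborel (\<lambda>x. std_normal_density x * exp (c * x))"
    by simp
  then show ?thesis
    by (subst integrable_density) (auto simp: normal_density_nonneg)
qed

text \<open>The hypothesis concerns imaginary exponents only. Levy uniqueness identifies the law of
  \<open>X\<close> as standard normal, which gives access to real exponents.\<close>

lemma integrable_exp_abs_std_normal_char:
  assumes "prob_space M" and [measurable]: "X \<in> borel_measurable M"
    and char: "\<And>t. (CLINT x|M. iexp (t * X x)) = exp (- (t\<^sup>2) / 2)"
  shows "integrable M (\<lambda>x. exp (c * \<bar>X x\<bar>))"
proof -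
  interpret prob_space M by fact
  have "char (distr M borel X) = char std_normal_distribution"
    using char by (simp add: fun_eq_iff char_std_normal_distribution char_def integral_distr)
  then have "distr M borel X = std_normal_distribution"
    by (intro Levy_uniqueness real_dist_normal_dist real_distribution_distr) simp_all
  then have int: "integrable M (\<lambda>x. exp (c * X x))" for c
    using integrable_exp_std_normal[of c]
      integrable_distr_eq[of X M borel "\<lambda>x. exp (c * x)"] by simp
  \<comment> \<open>One of the two summands equals \<open>exp (c * \<bar>X x\<bar>)\<close>, so the
    sum dominates it.\<close>
  have "integrable M (\<lambda>x. exp (c * X x) + exp (- c * X x))"
    by (intro Bochner_Integration.integrable_add int)
  then show ?thesis
    by (rule Bochner_Integration.integrable_bound) (auto simp: abs_of_nonneg[OF add_nonneg_nonneg] abs_if[of "X _"])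
qed

lemma norm_sum_exp_partial_le:
  fixes z :: complex
  shows "norm (\<Sum>k<n. z ^ k /\<^sub>R fact k) \<le> exp (norm z)"
proof -
  have "norm (\<Sum>k<n. z ^ k /\<^sub>R fact k) \<le> (\<Sum>k<n. norm z ^ k /\<^sub>R fact k)"
    by (intro order_trans[OF norm_sum] sum_mono) (simp add: norm_power norm_mult norm_divide)
  also have "\<dots> \<le> exp (norm z)"
    unfolding exp_def by (intro sum_le_suminf summable_exp_generic) auto
  finally show ?thesis .
qed

text \<open>Integrating the exponential series termwise exhibits a power series in \<open>z\<close>;
  \<open>exp (norm z * \<bar>X x\<bar>)\<close> dominates all partial sums.\<close>

lemma exp_moment_holomorphic:
  fixes X :: "'a \<Rightarrow> real" and f :: "'a \<Rightarrow> complex"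
  assumes [measurable]: "X \<in> borel_measurable M" "f \<in> borel_measurable M"
    and int: "\<And>c. integrable M (\<lambda>x. exp (c * \<bar>X x\<bar>))"
    and f: "\<And>x. norm (f x) \<le> 1"
  shows "(\<lambda>z. CLINT x|M. exp (z * X x) * f x) holomorphic_on ball 0 R"
proof (rule power_series_holomorphic)
  fix z :: complex
  let ?t = "\<lambda>k x. (z * X x) ^ k /\<^sub>R fact k * f x"
  have bound: "norm (\<Sum>k<n. ?t k x) \<le> exp (norm z * \<bar>X x\<bar>)" for n x
  proof -
    have "norm (\<Sum>k<n. ?t k x) = norm (\<Sum>k<n. (z * X x) ^ k /\<^sub>R fact k) * norm (f x)"
      by (simp only: sum_distrib_right[symmetric] norm_mult)
    also have "\<dots> \<le> exp (norm (z * X x)) * 1"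
      by (intro mult_mono norm_sum_exp_partial_le f) auto
    finally show ?thesis
      by (simp add: norm_mult)
  qed
  have lim: "(\<lambda>n. \<Sum>k<n. ?t k x) \<longlonglongrightarrow> exp (z * X x) * f x" for x
    using sums_mult2[OF exp_converges[of "z * X x"], of "f x"] by (simp add: sums_def)
  have int_sum: "integrable M (\<lambda>x. \<Sum>k<n. ?t k x)" for n
    by (rule integrable_dominated_convergence2
        [where f="\<lambda>x. exp (z * X x) * f x" and w="\<lambda>x. exp (norm z * \<bar>X x\<bar>)"
          and s="\<lambda>n x. \<Sum>k<n. ?t k x"])
      (use int bound lim in auto)
  \<comment> \<open>A single term is the difference of two consecutive partial sums, which spares a
    separate bound on the moments of \<open>X\<close>.\<close>
  have int_t: "integrable M (?t n)" for n
  proof -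
    have "integrable M (\<lambda>x. (\<Sum>k<Suc n. ?t k x) - (\<Sum>k<n. ?t k x))"
      by (intro Bochner_Integration.integrable_diff int_sum)
    then show ?thesis
      by simp
  qed
  have "(\<lambda>n. CLINT x|M. \<Sum>k<n. ?t k x) \<longlonglongrightarrow> (CLINT x|M. exp (z * X x) * f x)"
    by (rule integral_dominated_convergence[where w="\<lambda>x. exp (norm z * \<bar>X x\<bar>)"])
      (use int bound lim in auto)
  also have "(\<lambda>n. CLINT x|M. \<Sum>k<n. ?t k x) = (\<lambda>n. \<Sum>k<n. CLINT x|M. ?t k x)"
    using int_t by (simp add: fun_eq_iff)
  finally have "(\<lambda>k. CLINT x|M. ?t k x) sums (CLINT x|M. exp (z * X x) * f x)"
    by (simp add: sums_def)
  moreover have "(CLINT x|M. ?t k x) = (CLINT x|M. X x ^ k /\<^sub>R fact k * f x) * (z - 0) ^ k" for k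
    unfolding integral_mult_left_zero[symmetric]
    by (intro Bochner_Integration.integral_cong) (auto simp: power_mult_distrib scaleR_conv_of_real)
  ultimately show "(\<lambda>k. (CLINT x|M. X x ^ k /\<^sub>R fact k * f x) * (z - 0) ^ k) sums
      (CLINT x|M. exp (z * X x) * f x)"
    by simp
qed

text \<open>Both sides are entire in \<open>z\<close> and agree on the imaginary axis.\<close>

lemma gaussian_exp_moment:
  fixes X Y :: "'a \<Rightarrow> real" and A B C :: real and z :: complex
  assumes [measurable]: "X \<in> borel_measurable M" "Y \<in> borel_measurable M"
    and int: "\<And>c. integrable M (\<lambda>x. exp (c * \<bar>X x\<bar>))"
    and char: "\<And>t. (CLINT x|M. iexp (t * X x + Y x)) = exp (- (A * t\<^sup>2 + 2 * B * t + C))"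
  shows "(CLINT x|M. exp (z * X x + \<i> * Y x)) = exp (A * z\<^sup>2 + 2 * \<i> * B * z - C)"
proof -
  define F where "F z = (CLINT x|M. exp (z * X x) * iexp (Y x)) - exp (A * z\<^sup>2 + 2 * \<i> * B * z - C)"
    for z :: complex
  define R where "R = norm z + 1"
  have "R > 0"
    by (simp add: R_def add_nonneg_pos)
  have "F z = 0"
  proof (rule analytic_continuation[where f=F and S="ball 0 R" and \<xi>=0])
    show "F holomorphic_on ball 0 R"
      unfolding F_def
      by (intro holomorphic_intros exp_moment_holomorphic int) auto
    show "{w \<in> ball 0 R. Re w = 0} \<subseteq> ball 0 R"
      by auto
    \<comment> \<open>The points \<open>\<i> * t\<close> with small \<open>t > 0\<close> accumulate
      at the centre, so the identity theorem applies to the axis.\<close>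
    show "0 islimpt {w \<in> ball 0 R. Re w = 0}"
      unfolding islimpt_approachable
    proof (intro allI impI)
      fix e :: real
      assume "0 < e"
      define t where "t = min e R / 2"
      have "0 < t" "t < e" "t < R"
        using \<open>0 < e\<close> \<open>0 < R\<close> by (auto simp: t_def min_def)
      then show "\<exists>w\<in>{w \<in> ball 0 R. Re w = 0}. w \<noteq> 0 \<and> dist w 0 < e"
        by (intro bexI[of _ "\<i> * t"]) (auto simp: norm_mult)
    qed
    show "F w = 0" if "w \<in> {w \<in> ball 0 R. Re w = 0}" for w
    proof -
      define t where "t = Im w"
      have w: "w = \<i> * t"
        using that by (simp add: t_def complex_eq_iff)
      have "(CLINT x|M. exp (w * X x) * iexp (Y x)) = (CLINT x|M. iexp (t * X x + Y x))"
        by (simp add: w algebra_simps flip: exp_add)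
      \<comment> \<open>For \<open>w = \<i> * t\<close> the square of \<open>w\<close> is minus that
        of \<open>t\<close>, and \<open>2 * \<i> * B * w\<close> is
        \<open>- 2 * B * t\<close>.\<close>
      also have "\<dots> = exp (A * w\<^sup>2 + 2 * \<i> * B * w - C)"
        unfolding char exp_of_real[symmetric]
        by (rule arg_cong[where f=exp]) (simp add: w power_mult_distrib)
      finally show ?thesis
        by (simp add: F_def)
    qed
  qed (use \<open>0 < R\<close> in \<open>auto simp: R_def\<close>)
  then show ?thesis
    by (simp add: F_def exp_add)
qed

section \<open>Gaussian integrals over the algebraic dual\<close>

abbreviation inner_functional :: "'l::real_inner set \<Rightarrow> 'l \<Rightarrow> 'l \<Rightarrow> real" where
  "inner_functional W \<xi> \<equiv> (\<lambda>\<phi>\<in>W. inner \<xi> \<phi>)"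

lemma inner_functional_in_top_dual:
  assumes "subspace W"
  shows "inner_functional W \<xi> \<in> top_dual W"
proof -
  have "continuous_on W (inner_functional W \<xi>)"
    by (subst continuous_on_cong[OF refl restrict_apply'])
      (auto intro: continuous_intros)
  then show ?thesis
    using assms by (auto simp: top_dual_def inner_add_right subspace_add subspace_scale)
qed

lemma hat_inner_functional_scaleR:
  assumes "subspace W" "\<Phi> \<in> hat W"
  shows "\<Phi> (inner_functional W (c *\<^sub>R \<xi>)) = c * \<Phi> (inner_functional W \<xi>)"
proof -
  have eq: "inner_functional W (c *\<^sub>R \<xi>) = (\<lambda>\<phi>\<in>W. c * inner_functional W \<xi> \<phi>)"
    by auto
  show ?thesis
    using assms(2) inner_functional_in_top_dual[OF assms(1)] unfolding eq hat_def by blast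
qed

lemma hat_inner_functional_add:
  assumes "subspace W" "\<Phi> \<in> hat W"
  shows "\<Phi> (inner_functional W (\<xi> + \<xi>')) =
    \<Phi> (inner_functional W \<xi>) + \<Phi> (inner_functional W \<xi>')"
proof -
  have eq: "inner_functional W (\<xi> + \<xi>') =
      (\<lambda>\<phi>\<in>W. inner_functional W \<xi> \<phi> + inner_functional W \<xi>' \<phi>)"
    by (auto simp: inner_add_left)
  show ?thesis
    using assms(2) inner_functional_in_top_dual[OF assms(1)] unfolding eq hat_def by blast
qed

lemma measurable_hat_eval_at:
  assumes "l \<in> top_dual W"
  shows "(\<lambda>\<Phi>. \<Phi> l) \<in> borel_measurable (hat_sigma W)"
proof (rule measurableI)
  fix B :: "real set"
  assume B: "B \<in> sets borel"
  have space: "space (hat_sigma W) = hat W"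
    unfolding hat_sigma_def by (rule space_measure_of) auto
  have "{\<Phi> \<in> hat W. \<Phi> l \<in> B} \<in> sets (hat_sigma W)"
    unfolding hat_sigma_def using assms B by (intro in_measure_of) auto
  then show "(\<lambda>\<Phi>. \<Phi> l) -` B \<inter> space (hat_sigma W) \<in> sets (hat_sigma W)"
    unfolding space by (simp add: Collect_conj_eq Int_commute vimage_def)
qed simp

context
  fixes W :: "'l::complex_inner set" and \<nu>
  assumes W: "subspace W" and \<nu>: "gaussian_on_hat W \<nu>"
begin

lemma gaussian_char:
  "\<xi> \<in> W \<Longrightarrow> (CLINT \<Phi>|\<nu>. iexp (\<Phi> (inner_functional W \<xi>))) = exp (- inner \<xi> \<xi>)"
  using \<nu> by (simp add: gaussian_on_hat_def g_form_eq_inner)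

lemma measurable_inner_functional [measurable]:
  "(\<lambda>\<Phi>. \<Phi> (inner_functional W \<xi>)) \<in> borel_measurable \<nu>"
  using measurable_hat_eval_at[OF inner_functional_in_top_dual[OF W]] \<nu>
  by (simp add: gaussian_on_hat_def cong: measurable_cong_sets)

text \<open>Evaluation at the functional of \<open>\<xi>\<close> is normal; division by its standard
  deviation reduces to the standard case. For \<open>\<xi> = 0\<close> it vanishes identically and
  no such division is possible.\<close>

lemma integrable_exp_abs_inner_functional:
  assumes "\<xi> \<in> W"
  shows "integrable \<nu> (\<lambda>\<Phi>. exp (c * \<bar>\<Phi> (inner_functional W \<xi>)\<bar>))"
proof -
  have prob: "prob_space \<nu>" and space: "space \<nu> = hat W"
    using \<nu> by (auto simp: gaussian_on_hat_def)
  interpret prob_space \<nu> by fact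
  show ?thesis
  proof (cases "\<xi> = 0")
    case True
    have "\<Phi> (inner_functional W \<xi>) = 0" if "\<Phi> \<in> hat W" for \<Phi>
      using hat_inner_functional_scaleR[OF W that, of 0 \<xi>] True by simp
    then show ?thesis
      using Bochner_Integration.integrable_cong[of \<nu> \<nu> "\<lambda>\<Phi>. exp (c * \<bar>\<Phi> (inner_functional W \<xi>)\<bar>)" "\<lambda>_. 1"] space
      by simp
  next
    case False
    \<comment> \<open>The characteristic function exp(- t^2 g(\<xi>, \<xi>)) belongs to variance 2
      g(\<xi>, \<xi>), whose root is \<open>s\<close>.\<close>
    define s where "s = sqrt 2 * norm \<xi>"
    have "s > 0"
      using False by (simp add: s_def)
    let ?X = "\<lambda>\<Phi>. \<Phi> (inner_functional W ((1 / s) *\<^sub>R \<xi>))"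
    have scale: "\<Phi> (inner_functional W ((t / s) *\<^sub>R \<xi>)) = t * ?X \<Phi>" if "\<Phi> \<in> hat W" for t \<Phi>
      using hat_inner_functional_scaleR[OF W that, of t "(1 / s) *\<^sub>R \<xi>"]
      by (simp only: scaleR_scaleR times_divide_eq_right mult_1_right)
    have "integrable \<nu> (\<lambda>\<Phi>. exp (c * s * \<bar>?X \<Phi>\<bar>))"
    proof (rule integrable_exp_abs_std_normal_char[OF prob])
      fix t :: real
      have "(CLINT \<Phi>|\<nu>. iexp (t * ?X \<Phi>)) =
          (CLINT \<Phi>|\<nu>. iexp (\<Phi> (inner_functional W ((t / s) *\<^sub>R \<xi>))))"
        by (intro Bochner_Integration.integral_cong refl) (simp only: space scale[symmetric])
      also have "\<dots> = exp (- inner ((t / s) *\<^sub>R \<xi>) ((t / s) *\<^sub>R \<xi>))"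
        using \<open>\<xi> \<in> W\<close> W by (intro gaussian_char subspace_scale)
      also have "- inner ((t / s) *\<^sub>R \<xi>) ((t / s) *\<^sub>R \<xi>) = - (t\<^sup>2) / 2"
        using False by (simp add: s_def power2_eq_square dot_square_norm)
      finally show "(CLINT \<Phi>|\<nu>. iexp (t * ?X \<Phi>)) = exp (- (t\<^sup>2) / 2)" .
    qed (rule measurable_inner_functional)
    also have "?this \<longleftrightarrow> ?thesis"
    proof (intro Bochner_Integration.integrable_cong refl)
      fix \<Phi>
      assume "\<Phi> \<in> space \<nu>"
      then have "\<Phi> (inner_functional W \<xi>) = s * ?X \<Phi>"
        using scale[of \<Phi> s] \<open>s > 0\<close> by (simp add: space del: inner_scaleR_left)
      then show "exp (c * s * \<bar>?X \<Phi>\<bar>) = exp (c * \<bar>\<Phi> (inner_functional W \<xi>)\<bar>)"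
        using \<open>s > 0\<close> by (simp only: abs_mult abs_of_pos mult.assoc)
    qed
    finally show ?thesis .
  qed
qed

text \<open>Formally the characteristic function at \<eta> - \<i>\<xi>, with the inner product
  extended complex bilinearly.\<close>

lemma gaussian_exp_complex:
  assumes "\<xi> \<in> W" "\<eta> \<in> W"
  shows "(CLINT \<Phi>|\<nu>. exp (Complex (\<Phi> (inner_functional W \<xi>)) (\<Phi> (inner_functional W \<eta>)))) =
    exp (inner \<xi> \<xi> + 2 * \<i> * inner \<xi> \<eta> - inner \<eta> \<eta>)"
proof -
  have space: "space \<nu> = hat W"
    using \<nu> by (auto simp: gaussian_on_hat_def)
  have "(CLINT \<Phi>|\<nu>. iexp (t * \<Phi> (inner_functional W \<xi>) + \<Phi> (inner_functional W \<eta>))) =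
      exp (- (inner \<xi> \<xi> * t\<^sup>2 + 2 * inner \<xi> \<eta> * t + inner \<eta> \<eta>))" for t
  proof -
    have "(CLINT \<Phi>|\<nu>. iexp (t * \<Phi> (inner_functional W \<xi>) + \<Phi> (inner_functional W \<eta>))) =
        (CLINT \<Phi>|\<nu>. iexp (\<Phi> (inner_functional W (t *\<^sub>R \<xi> + \<eta>))))"
      by (intro Bochner_Integration.integral_cong refl)
        (simp only: space hat_inner_functional_add[OF W] hat_inner_functional_scaleR[OF W])
    also have "\<dots> = exp (- inner (t *\<^sub>R \<xi> + \<eta>) (t *\<^sub>R \<xi> + \<eta>))"
      using assms W by (intro gaussian_char subspace_add subspace_scale)
    finally show ?thesis
      by (simp add: algebra_simps inner_commute power2_eq_square)
  qed
  \<comment> \<open>Continuation to \<open>z = 1\<close> makes the exponent belonging to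
    \<open>\<xi>\<close> real, while that of \<open>\<eta>\<close> stays imaginary.\<close>
  from gaussian_exp_moment[OF _ _ _ this, of 1] show ?thesis
    using assms by (simp add: integrable_exp_abs_inner_functional Complex_eq)
qed

end

text \<open>Only restrictions to \<open>W\<close> matter. Against \<open>W\<close>, the term J v
  drops out of the real part g(u + J v, .) and J u out of the imaginary part g(J u - v, .), because
  J maps \<open>W\<close> into its orthogonal complement.\<close>

lemma hat_eval_hat_incl_cinner:
  fixes W :: "'l::{complex_inner, complete_space} set"
  assumes W: "closed_lagrangian W" and "u \<in> W" "v \<in> W"
  shows "hat_eval (hat_incl W \<Phi>) (cinner (u + J_map v)) =
    Complex (\<Phi> (inner_functional W u)) (\<Phi> (inner_functional W (- v)))"
proof -
  have Re: "inner (u + J_map v) \<phi> = inner u \<phi>" if "\<phi> \<in> W" for \<phi>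
    using that lagrangian_iff[OF W, of v] \<open>v \<in> W\<close> by (simp add: inner_add_left)
  have Im: "inner (J_map (u + J_map v)) \<phi> = inner (- v) \<phi>" if "\<phi> \<in> W" for \<phi>
    using that lagrangian_iff[OF W, of u] \<open>u \<in> W\<close> by (simp add: J_map_add inner_diff_left)
  have "inner x \<in> top_dual UNIV" for x :: 'l
    using inner_functional_in_top_dual[OF subspace_UNIV, of x] unfolding restrict_def by simp
  then have dual: "(\<lambda>\<phi>. Re (cinner x \<phi>)) \<in> top_dual UNIV" "(\<lambda>\<phi>. Im (cinner x \<phi>)) \<in> top_dual UNIV"
    for x :: 'l
    by (simp_all only: Im_cinner inner_eq_Re_cinner[symmetric])
  have "restrict (\<lambda>\<phi>. Re (cinner (u + J_map v) \<phi>)) W = inner_functional W u"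
    by (rule restrict_ext) (simp only: inner_eq_Re_cinner[symmetric] Re)
  moreover have "restrict (\<lambda>\<phi>. Im (cinner (u + J_map v) \<phi>)) W = inner_functional W (- v)"
    by (rule restrict_ext) (simp only: Im_cinner Im)
  ultimately show ?thesis
    by (simp only: hat_eval_def hat_incl_def restrict_apply'[OF dual(1)] restrict_apply'[OF dual(2)])
qed

section \<open>Coherent states relative to a base point\<close>

context affine_action
begin

lemma aff_diff_eqI: "act p v = q \<Longrightarrow> aff_diff act q p = v"
  unfolding aff_diff_def using act_free_transitive by (intro the1_equality)

lemma act_aff_diff: "act p (aff_diff act q p) = q"
  unfolding aff_diff_def using act_free_transitive by (rule theI')

lemma act_eq_iff: "act p v = act p w \<longleftrightarrow> v = w"
  using act_free_transitive by blast

end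

context boundary_data
begin

lemma aff_diff_act: "aff_diff act (act p v) (act p \<xi>) = v - \<xi>"
  by (rule aff_diff_eqI) (simp add: act_add)

lemmas theta_add = linear_add[OF theta_linear]
lemmas theta_diff = linear_diff[OF theta_linear]
lemmas br_add_left = bilinear_ladd[OF br_bilinear]
lemmas br_add_right = bilinear_radd[OF br_bilinear]
lemmas br_diff_left = bilinear_lsub[OF br_bilinear]
lemmas br_diff_right = bilinear_rsub[OF br_bilinear]

lemma br_antisym: "br v w - br w v = inner (J_map v) w"
  using omega_br[of v w] by (simp add: omega_form_eq_inner)

text \<open>The terms quadratic in \<open>v\<close> cancel in the quotient. Of the linear ones, the
  bracket survives only antisymmetrized, as the imaginary part of the complex inner product, and the
  cross term of the Gaussian factor supplies the real part.\<close>

lemma chi_coherent_state: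
  "chi act \<theta> p (coherent_state act \<theta> (act p \<xi>)) v =
    exp (- \<i> * \<theta> p \<xi> - \<i>/2 * br \<xi> \<xi> - 1/4 * inner \<xi> \<xi>) * exp (cinner ((1/2) *\<^sub>R \<xi>) v)"
proof -
  \<comment> \<open>The factor 1/2 sits inside \<open>cinner\<close> so that the functional is
    itself of the form \<open>cinner x\<close>.\<close>
  have half: "cinner ((1/2) *\<^sub>R \<xi>) v = 1/2 * (inner \<xi> v + \<i> * (br \<xi> v - br v \<xi>))"
    by (simp add: complex_eq_iff scaleR_eq_scaleC cinner_scaleC_left br_antisym Im_cinner
        flip: inner_eq_Re_cinner)
  have base: "aff_diff act (act p v) p = v"
    by (rule aff_diff_eqI) simp
  have tr: "\<theta> (act p x) y = br x y + \<theta> p y" for x y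
    by (simp add: theta_translate)
  show ?thesis
    unfolding chi_def coherent_state_def aff_diff_act base half exp_diff[symmetric] exp_add[symmetric]
      g_form_eq_inner tr
    by (rule arg_cong[where f=exp])
      (simp add: theta_diff br_diff_left br_diff_right inner_diff_left inner_diff_right
        inner_commute[of v \<xi>] field_simps)
qed

end

section \<open>The amplitude of a coherent state\<close>

context region_data
begin

lemma subspace_range_r: "subspace (range r)"
  by (rule lagrangian_subspace[OF lagrangian])

lemma boundary_action_eq: "boundary_action a S (a \<eta>) = S \<eta>"
  unfolding boundary_action_def by (rule the_equality) (auto intro: S_boundary)

lemma range_a_iff: "q \<in> range a \<longleftrightarrow> (\<exists>v\<in>range r. q = act (a \<eta>) v)"
proof
  assume "q \<in> range a"
  then obtain \<eta>' where "q = a \<eta>'"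
    by blast
  then have "q = act (a \<eta>) (r (aff_diff actM \<eta>' \<eta>))"
    by (simp add: bulk.act_aff_diff flip: a_compatible)
  then show "\<exists>v\<in>range r. q = act (a \<eta>) v"
    by blast
qed (auto simp flip: a_compatible)

text \<open>Expanding \<open>\<theta> (a \<eta>')\<close> around \<open>a \<eta>\<close> merges the
  two halves of \<open>S_difference\<close> and leaves one bracket term.\<close>

lemma S_translate:
  assumes "a \<eta>' = act (a \<eta>) u" "u \<in> range r"
  shows "S \<eta>' = S \<eta> - \<theta> (a \<eta>) u - 1/2 * br u u"
proof -
  have "act (a \<eta>) (r (aff_diff actM \<eta>' \<eta>)) = a \<eta>'"
    by (metis a_compatible bulk.act_aff_diff)
  \<comment> \<open>\<open>r\<close> may fail to be injective, but freeness of the boundary action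
    determines the image of the bulk difference.\<close>
  then have "r (aff_diff actM \<eta>' \<eta>) = u"
    using assms(1) act_eq_iff by simp
  then show ?thesis
    using S_difference[of \<eta>' \<eta>] by (simp add: assms(1) field_simps flip: theta_translate)
qed

lemma unique_decomposition:
  "\<exists>!d. fst d \<in> range a \<and> snd d \<in> range r \<and> \<zeta> = act (fst d) (J_map (snd d))"
proof (rule ex_ex1I)
  \<comment> \<open>An arbitrary bulk point serves as origin, reducing existence to the linear
    decomposition.\<close>
  fix \<eta> :: 'b
  obtain u v where uv: "u \<in> range r" "v \<in> range r" "aff_diff act \<zeta> (a \<eta>) = u + J_map v"
    by (rule lagrangian_decomposition[OF lagrangian])
  have "\<zeta> = act (act (a \<eta>) u) (J_map v)"
    by (metis act_add act_aff_diff uv(3))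
  then show "\<exists>d. fst d \<in> range a \<and> snd d \<in> range r \<and> \<zeta> = act (fst d) (J_map (snd d))"
    using uv(1,2) range_a_iff[of _ \<eta>] by (intro exI[of _ "(act (a \<eta>) u, v)"]) auto
next
  fix d d'
  assume d: "fst d \<in> range a \<and> snd d \<in> range r \<and> \<zeta> = act (fst d) (J_map (snd d))"
    and d': "fst d' \<in> range a \<and> snd d' \<in> range r \<and> \<zeta> = act (fst d') (J_map (snd d'))"
  then obtain u where u: "u \<in> range r" "fst d' = act (fst d) u"
    using range_a_iff by (metis rangeE)
  have "act (fst d) (J_map (snd d)) = act (fst d) (u + J_map (snd d'))"
    using d d' u(2) act_add by metis
  \<comment> \<open>This vector lies both in the Lagrangian subspace and in its image under J, so it
    must vanish.\<close>
  then have "J_map (snd d - snd d') = u"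
    by (simp add: act_eq_iff J_map_diff)
  then have "snd d - snd d' = 0"
    using u(1) d d' subspace_range_r
    by (intro lagrangian_J_map_disjoint[OF lagrangian]) (auto intro: subspace_diff)
  moreover from this have "u = 0"
    using \<open>J_map (snd d - snd d') = u\<close> linear_0[OF linear_J_map] by metis
  ultimately show "d = d'"
    using u(2) by (simp add: prod_eq_iff act_zero)
qed

text \<open>The base point \<open>\<eta>\<close> is arbitrary, so the computation also shows that
  the amplitude of a coherent state does not depend on it.\<close>

lemma amplitude_coherent_state:
  assumes \<nu>: "gaussian_on_hat (range r) \<nu>"
    and "\<zeta>R \<in> range a" and v: "v \<in> range r"
  shows "amplitude act \<theta> S a r \<nu> \<eta> (coherent_state act \<theta> (act \<zeta>R (J_map v))) =
    exp (\<i> * of_real (boundary_action a S \<zeta>R) - \<i> * of_real (\<theta> \<zeta>R (J_map v))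
       - \<i>/2 * of_real (br (J_map v) (J_map v)) - 1/2 * of_real (g_form v v))"
proof -
  obtain u where u: "u \<in> range r" "\<zeta>R = act (a \<eta>) u"
    using assms(2) range_a_iff by blast
  define \<xi> where "\<xi> = u + J_map v"
  define c where "c = exp (- \<i> * \<theta> (a \<eta>) \<xi> - \<i>/2 * br \<xi> \<xi> - 1/4 * inner \<xi> \<xi>)"
  have \<zeta>: "act \<zeta>R (J_map v) = act (a \<eta>) \<xi>"
    by (simp add: u(2) \<xi>_def act_add)
  have half: "(1/2) *\<^sub>R \<xi> = (1/2) *\<^sub>R u + J_map ((1/2) *\<^sub>R v)"
    by (simp add: \<xi>_def J_map_scaleR scaleR_add_right)
  have half_range: "(1/2) *\<^sub>R u \<in> range r" "(1/2) *\<^sub>R v \<in> range r" "- ((1/2) *\<^sub>R v) \<in> range r"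
    using u(1) v subspace_range_r by (auto intro!: subspace_scale subspace_neg)
  \<comment> \<open>Written as a sum over a singleton to match
    \<open>hat_ext_exp_sum\<close>.\<close>
  have chi: "chi act \<theta> (a \<eta>) (coherent_state act \<theta> (act \<zeta>R (J_map v))) =
      (\<lambda>\<phi>. \<Sum>l\<in>{cinner ((1/2) *\<^sub>R \<xi>)}. c * exp (l \<phi>))"
    by (simp add: \<zeta> chi_coherent_state c_def fun_eq_iff)
  have "(CLINT \<Phi>|\<nu>. hat_ext (chi act \<theta> (a \<eta>) (coherent_state act \<theta> (act \<zeta>R (J_map v))))
        (hat_incl (range r) \<Phi>)) =
      c * exp (inner ((1/2) *\<^sub>R u) ((1/2) *\<^sub>R u)
        + 2 * \<i> * inner ((1/2) *\<^sub>R u) (- ((1/2) *\<^sub>R v))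
        - inner (- ((1/2) *\<^sub>R v)) (- ((1/2) *\<^sub>R v)))"
    unfolding chi hat_ext_exp_sum[OF finite.insertI[OF finite.emptyI]
        insert_subsetI[OF cinner_in_complex_top_dual empty_subsetI]]
    by (simp only: half hat_eval_hat_incl_cinner[OF lagrangian half_range(1,2)] sum.insert
        finite.emptyI empty_iff not_False_eq_True sum.empty add_0_right integral_mult_right_zero
        gaussian_exp_complex[OF subspace_range_r \<nu> half_range(1,3)])
  then have amp: "amplitude act \<theta> S a r \<nu> \<eta> (coherent_state act \<theta> (act \<zeta>R (J_map v))) =
      exp (\<i> * S \<eta>) * (c * exp (1/4 * inner u u - \<i>/2 * inner u v - 1/4 * inner v v))"
    by (simp add: amplitude_def)
  have orth: "inner u (J_map v) = 0"
  proof -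
    have "inner (J_map u) v = 0"
      using lagrangian_iff[OF lagrangian, of u] u(1) v by blast
    then show ?thesis
      by (simp add: inner_J_map_right)
  qed
  have norm: "inner \<xi> \<xi> = inner u u + inner v v"
    using orth by (simp add: \<xi>_def inner_add_left inner_add_right inner_J_map_J_map inner_commute)
  \<comment> \<open>Converts the mixed Gaussian term into brackets: with the cross terms of
    \<open>br \<xi> \<xi>\<close> it adds up to \<open>- \<i> * br u (J_map v)\<close>, exactly what
    moving \<open>\<theta>\<close> from \<open>a \<eta>\<close> to \<open>\<zeta>R\<close>
    contributes.\<close>
  have br: "br u (J_map v) - br (J_map v) u = inner u v"
    by (simp add: br_antisym inner_J_map_J_map)
  obtain \<eta>' where \<eta>': "\<zeta>R = a \<eta>'"
    using assms(2) by blast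
  have S: "boundary_action a S \<zeta>R = S \<eta> - \<theta> (a \<eta>) u - 1/2 * br u u"
    using S_translate[OF _ u(1), of \<eta>' \<eta>] u(2) \<eta>' boundary_action_eq[of \<eta>'] by simp
  have \<theta>: "\<theta> \<zeta>R (J_map v) = br u (J_map v) + \<theta> (a \<eta>) (J_map v)"
    by (simp add: u(2) theta_translate)
  show ?thesis
    unfolding amp c_def exp_add[symmetric] S \<theta> g_form_eq_inner norm br[symmetric]
    by (rule arg_cong[where f=exp])
      (simp add: \<xi>_def theta_add br_add_left br_add_right algebra_simps)
qed

end

theorem proposition4p3:
  fixes act :: "'a::topological_space \<Rightarrow> 'l::{complex_inner, complete_space} \<Rightarrow> 'a"
    and \<theta> :: "'a \<Rightarrow> 'l \<Rightarrow> real"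
    and br :: "'l \<Rightarrow> 'l \<Rightarrow> real"
    and actM :: "'b \<Rightarrow> 'm::real_vector \<Rightarrow> 'b"
    and S :: "'b \<Rightarrow> real"
    and a :: "'b \<Rightarrow> 'a"
    and r :: "'m \<Rightarrow> 'l"
    and \<nu> :: "(('l \<Rightarrow> real) \<Rightarrow> real) measure"
    and \<zeta> :: 'a
  assumes "region_data act \<theta> br actM S a r"
    and "gaussian_on_hat (range r) \<nu>"
  shows "(\<exists>!d. fst d \<in> range a \<and> snd d \<in> range r \<and> \<zeta> = act (fst d) (J_map (snd d))) \<and>
    (\<forall>\<zeta>R \<zeta>I. \<zeta>R \<in> range a \<and> \<zeta>I \<in> range r \<and> \<zeta> = act \<zeta>R (J_map \<zeta>I) \<longrightarrow>
      (\<forall>\<eta>. amplitude act \<theta> S a r \<nu> \<eta> (coherent_state act \<theta> \<zeta>) =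
        exp (\<i> * of_real (boundary_action a S \<zeta>R)
           - \<i> * of_real (\<theta> \<zeta>R (J_map \<zeta>I))
           - \<i>/2 * of_real (br (J_map \<zeta>I) (J_map \<zeta>I))
           - 1/2 * of_real (g_form \<zeta>I \<zeta>I))))"
proof -
  interpret region_data act \<theta> br actM S a r by fact
  show ?thesis
    using unique_decomposition amplitude_coherent_state[OF assms(2)] by blast
qed

end
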